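(* Let $q$ and $s$ be indeterminates and consider linear operators on the space of polynomials in $x$. Let $X$ be multiplication by $x$, $D_q$ the $q$-differentiation operator $D_qf(x)=\frac{f(qx)-f(x)}{(q-1)x}$, and for a polynomial $g$ let $g(X)$ be multiplication by $g(x)$. For integers $k\ge0$ and $n\ge 1$ (and also $n=0$ when $k\ge1$) define $$L_n^{(k)}(x,s)=\sum_{j=0}^{\lfloor n/2\rfloor} q^{\binom{j}{2}}\frac{[n+k]}{[n+k-j]}\begin{bmatrix} n+k-j\\ k\end{bmatrix}\begin{bmatrix} n-j\\ j\end{bmatrix}s^jx^{n-2j},$$ and set $L_0^{(k)}(x,s)=1$ for all $k\ge0$. Then for every $n\ge0$, $$\big(X+(1-q)sD_q\big)^n=\sum_{k=0}^n A(n,k,X)\,(1-q)^ks^kD_q^k,$$ where $$A(n,k,x)=\sum_{i=0}^{\lfloor (n-k)/2\rfloor}\binom{n}{i}s^i\,L^{(k)}_{n-2i-k}(x,-s).$$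
   Context: Notation: $[n]=\frac{1-q^n}{1-q}=1+q+\cdots+q^{n-1}$, $[n]!=[1][2]\cdots[n]$ with $[0]!=1$, $\begin{bmatrix} n\\ k\end{bmatrix}=\frac{[n]!}{[k]![n-k]!}$ is the $q$-binomial coefficient, $\binom{n}{i}$ is the ordinary binomial coefficient, and $\binom{j}{2}=j(j-1)/2$. *)

theory Defs
  imports "HOL-Computational_Algebra.Computational_Algebra"
begin

text \<open>
  The field of coefficients is the field of rational functions in two indeterminates over an
  arbitrary field \<open>'a\<close>, realised as the fraction field of \<open>'a[q][s]\<close>.
  The polynomials in \<open>x\<close> on which the operators act are the polynomials over that field.
\<close>

definition q_indet :: "'a::field poly poly fract"
  where "q_indet = to_fract [:[:0, 1:]:]"

definition s_indet :: "'a::field poly poly fract"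
  where "s_indet = to_fract [:0, 1:]"

definition q_nat :: "'b::field \<Rightarrow> nat \<Rightarrow> 'b"
  where "q_nat q n = (1 - q ^ n) / (1 - q)"

definition q_fact :: "'b::field \<Rightarrow> nat \<Rightarrow> 'b"
  where "q_fact q n = (\<Prod>i=1..n. q_nat q i)"

text \<open>Only meaningful for \<open>k \<le> n\<close>, because of the truncated subtraction.\<close>

definition q_binomial :: "'b::field \<Rightarrow> nat \<Rightarrow> nat \<Rightarrow> 'b"
  where "q_binomial q n k = q_fact q n / (q_fact q k * q_fact q (n - k))"

definition q_diff :: "'b::field \<Rightarrow> 'b poly \<Rightarrow> 'b poly"
  where "q_diff q f = (pcompose f [:0, q:] - f) div [:0, q - 1:]"

text \<open>The division in \<open>q_diff\<close> is exact:\<close>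

lemma q_diff_exact:
  assumes "q \<noteq> 1"
  shows "[:0, q - 1:] * q_diff q f = pcompose f [:0, q:] - f"
proof -
  have "poly (pcompose f [:0, q:] - f) 0 = 0"
    by (simp add: poly_pcompose)
  then have "[:0, 1:] dvd pcompose f [:0, q:] - f"
    using poly_eq_0_iff_dvd[of "pcompose f [:0, q:] - f" 0] by simp
  moreover have "[:0, q - 1:] = smult (q - 1) [:0, 1:]"
    by simp
  ultimately have "[:0, q - 1:] dvd pcompose f [:0, q:] - f"
    using assms by (simp only: smult_dvd_iff) simp
  then show ?thesis
    unfolding q_diff_def by (rule dvd_mult_div_cancel)
qed

text \<open>
  \<open>q_lucas q k n s\<close> is the polynomial \<open>L\<^sub>n\<^sup>(\<^sup>k\<^sup>)(x, s)\<close> in \<open>x\<close>. The case \<open>n = 0\<close> is separated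
  because the sum reads \<open>0 / 0\<close> for \<open>n = k = 0\<close>.
\<close>

definition q_lucas :: "'b::field \<Rightarrow> nat \<Rightarrow> nat \<Rightarrow> 'b \<Rightarrow> 'b poly"
  where "q_lucas q k n s =
    (if n = 0 then 1
     else \<Sum>j=0..n div 2.
       monom (q ^ (j choose 2) * (q_nat q (n + k) / q_nat q (n + k - j))
                * q_binomial q (n + k - j) k * q_binomial q (n - j) j * s ^ j) (n - 2 * j))"

definition A_poly :: "'b::field \<Rightarrow> 'b \<Rightarrow> nat \<Rightarrow> nat \<Rightarrow> 'b poly"
  where "A_poly q s n k =
    (\<Sum>i=0..(n - k) div 2. smult (of_nat (n choose i) * s ^ i) (q_lucas q k (n - 2 * i - k) (- s)))"

definition mult_op :: "'b::field poly \<Rightarrow> 'b poly \<Rightarrow> 'b poly"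
  where "mult_op g = (\<lambda>f. g * f)"

abbreviation X_op :: "'b::field poly \<Rightarrow> 'b poly"
  where "X_op \<equiv> mult_op [:0, 1:]"

end

theory Submission
  imports Defs
begin

text \<open>
  Put \<open>Y = (1 - q) s D\<^sub>q\<close>. Then \<open>Y X = q X Y + (1 - q) s\<close>, hence
  \<open>Y\<^sup>k X = q\<^sup>k X Y\<^sup>k + (1 - q\<^sup>k) s Y\<^sup>k\<^sup>-\<^sup>1\<close>. Multiplying the normal form of \<open>(X + Y)\<^sup>n\<close> by \<open>X + Y\<close>
  \<^emph>\<open>from the right\<close> therefore gives a recurrence for its coefficients that does not involve \<open>D\<^sub>q\<close>:
  \<open>A(n+1,k) = q\<^sup>k x A(n,k) + A(n,k-1) + (1 - q\<^sup>k\<^sup>+\<^sup>1) s A(n,k+1)\<close>.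
  By Pascal's rule the asserted formula satisfies it as soon as, for \<open>L\<close> taken at \<open>(x,-s)\<close>,
  \<open>L(k,m+1) + s L(k,m-1) = q\<^sup>k x L(k,m) + L(k-1,m+1) + (1 - q\<^sup>k\<^sup>+\<^sup>1) s L(k+1,m-1)\<close>,
  which is an identity between \<open>q\<close>-factorials. For \<open>k = 0\<close> the convention \<open>L(0,0) = 1\<close> (where the
  recurrence would want \<open>2\<close>) breaks it at \<open>m = 1\<close> and \<open>m = -1\<close>; in the sum over \<open>i\<close> the two defects
  cancel by the symmetry of the binomial coefficients.
\<close>

lemma smult_sum_right: "smult c (\<Sum>i\<in>I. f i) = (\<Sum>i\<in>I. smult c (f i))"
  by (rule poly_eqI) (simp add: coeff_sum sum_distrib_left)

section \<open>q-numbers and q-factorials for \<open>q\<close> not a root of unity\<close>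

locale generic_q =
  fixes q s :: "'b::field"
  assumes q_power_neq_1: "n > 0 \<Longrightarrow> q ^ n \<noteq> 1"
begin

lemma q_neq_1: "q \<noteq> 1"
  using q_power_neq_1[of 1] by simp

lemma q_nat_0 [simp]: "q_nat q 0 = 0"
  by (simp add: q_nat_def)

lemma q_nat_1 [simp]: "q_nat q (Suc 0) = 1"
  using q_neq_1 by (simp add: q_nat_def)

lemma q_nat_nonzero: "n > 0 \<Longrightarrow> q_nat q n \<noteq> 0"
  using q_power_neq_1[of n] q_neq_1 by (simp add: q_nat_def)

lemma q_nat_Suc_nonzero [simp]: "q_nat q (Suc n) \<noteq> 0"
  by (simp add: q_nat_nonzero)

lemma q_nat_add: "q_nat q (m + n) = q_nat q m + q ^ m * q_nat q n"
  using q_neq_1 by (simp add: q_nat_def field_simps power_add)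

lemma q_fact_0 [simp]: "q_fact q 0 = 1"
  by (simp add: q_fact_def)

lemma q_fact_Suc [simp]: "q_fact q (Suc n) = q_nat q (Suc n) * q_fact q n"
  by (simp add: q_fact_def mult.commute)

lemma q_fact_nonzero [simp]: "q_fact q n \<noteq> 0"
  by (induction n) auto

section \<open>Coefficients of the q-Lucas polynomials and their recurrence\<close>

text \<open>The coefficient of \<open>s\<^sup>j x\<^sup>e\<close> in \<open>L\<^sup>(\<^sup>k\<^sup>)\<close>, after cancelling \<open>[n - j]!\<close> with \<open>n = e + 2 j\<close>.\<close>

definition lucas_coeff :: "nat \<Rightarrow> nat \<Rightarrow> nat \<Rightarrow> 'b"
  where "lucas_coeff k e j =
    (if k = 0 \<and> e = 0 \<and> j = 0 then 1
     else q ^ (j choose 2) * q_nat q (e + 2 * j + k) * q_fact q (e + j + k - 1)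
            / (q_fact q k * q_fact q j * q_fact q e))"

text \<open>Naming the predecessor \<open>p\<close> removes the truncated subtraction and excludes
  the exceptional value at \<open>k = e = j = 0\<close>.\<close>

lemma lucas_coeff_eq:
  "e + j + k = Suc p \<Longrightarrow> lucas_coeff k e j =
    q ^ (j choose 2) * q_nat q (e + 2 * j + k) * q_fact q p / (q_fact q k * q_fact q j * q_fact q e)"
  by (auto simp: lucas_coeff_def)

lemma lucas_coeff_0: "lucas_coeff k e 0 = q_fact q (e + k) / (q_fact q k * q_fact q e)"
proof (cases "e + k")
  case 0
  then show ?thesis by (simp add: lucas_coeff_def)
next
  case (Suc p)
  then show ?thesis by (simp add: lucas_coeff_eq[of e 0 k p] numeral_2_eq_2)
qed

text \<open>By \<open>lucas_coeff_0\<close> these are q-binomial coefficients, and this is the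
  q-Pascal rule.\<close>

lemma lucas_coeff_rec_0:
  assumes "k > 0 \<or> e > 0"
  shows "lucas_coeff k e 0 =
    q ^ k * (if e = 0 then 0 else lucas_coeff k (e - 1) 0)
    + (if k = 0 then 0 else lucas_coeff (k - 1) e 0)"
proof (cases k; cases e)
  fix k' e' assume [simp]: "k = Suc k'" "e = Suc e'"
  have "q_nat q (Suc (Suc (e' + k'))) = q_nat q (Suc k') + q ^ Suc k' * q_nat q (Suc e')"
    using q_nat_add[of "Suc k'" "Suc e'"] by (simp add: ac_simps)
  then show ?thesis
    by (simp add: lucas_coeff_0 field_simps)
qed (use assms in \<open>simp_all add: lucas_coeff_0\<close>)

text \<open>This is the recurrence for L read at \<open>x^e (- s)^(Suc i)\<close>; the minus signs
  come from \<open>s = - (- s)\<close>. Pulling out common q-factorials leaves an identity between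
  q-numbers.\<close>

lemma lucas_coeff_rec_Suc:
  assumes "e + i + k > 0"
  shows "lucas_coeff k e (Suc i) - lucas_coeff k e i =
    q ^ k * (if e = 0 then 0 else lucas_coeff k (e - 1) (Suc i))
    + (if k = 0 then 0 else lucas_coeff (k - 1) e (Suc i))
    - (1 - q ^ Suc k) * lucas_coeff (Suc k) e i"
proof -
  obtain p where p: "e + i + k = Suc p"
    using assms by (metis Suc_pred)
  \<comment> \<open>The part shared by all five terms; what remains of each is a short
    product.\<close>
  define F where
    "F = q ^ (i choose 2) * q_fact q p / (q_fact q k * q_fact q (Suc i) * q_fact q e)"
  define a b c where "a = q ^ e" and "b = q ^ k" and "c = q ^ i"
  have ch: "q ^ (Suc i choose 2) = q ^ (i choose 2) * q ^ i"
    by (simp add: numeral_2_eq_2 power_add)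
  have 1: "lucas_coeff k e (Suc i) = F * (q ^ i * q_nat q (e + 2 * i + k + 2) * q_nat q (e + i + k))"
    using p by (subst lucas_coeff_eq[of _ _ _ "Suc p"]) (simp_all add: F_def ch ac_simps)
  have 2: "lucas_coeff k e i = F * (q_nat q (e + 2 * i + k) * q_nat q (Suc i))"
    using p by (subst lucas_coeff_eq[of _ _ _ p]) (simp_all add: F_def ac_simps)
  \<comment> \<open>The factor \<open>q_nat q e\<close> vanishes at \<open>e = 0\<close>, matching
    the \<open>if\<close>; \<open>q_nat q k\<close> does the same in the next fact.\<close>
  have 3: "(if e = 0 then 0 else lucas_coeff k (e - 1) (Suc i))
      = F * (q ^ i * q_nat q (e + 2 * i + k + 1) * q_nat q e)"
  proof (cases e)
    case (Suc e')
    then show ?thesis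
      using p by (subst lucas_coeff_eq[of _ _ _ p]) (simp_all add: F_def ch ac_simps)
  qed simp
  have 4: "(if k = 0 then 0 else lucas_coeff (k - 1) e (Suc i))
      = F * (q ^ i * q_nat q (e + 2 * i + k + 1) * q_nat q k)"
  proof (cases k)
    case (Suc k')
    then show ?thesis
      using p by (subst lucas_coeff_eq[of _ _ _ p]) (simp_all add: F_def ch ac_simps)
  qed simp
  have "q_nat q (Suc k) * lucas_coeff (Suc k) e i
      = F * (q_nat q (e + 2 * i + k + 1) * q_nat q (e + i + k) * q_nat q (Suc i))"
    using p by (subst lucas_coeff_eq[of _ _ _ "Suc p"]) (simp_all add: F_def ac_simps)
  \<comment> \<open>This supplies the \<open>q_nat q (Suc k)\<close> that lowers
    \<open>q_fact q (Suc k)\<close> to \<open>q_fact q k\<close>.\<close>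
  moreover have "1 - q ^ Suc k = (1 - q) * q_nat q (Suc k)"
    using q_neq_1 by (simp add: q_nat_def)
  ultimately have 5: "(1 - q ^ Suc k) * lucas_coeff (Suc k) e i
      = F * ((1 - q) * (q_nat q (e + 2 * i + k + 1) * q_nat q (e + i + k) * q_nat q (Suc i)))"
    by (simp only: mult.assoc mult.left_commute)
  have pow: "q ^ (e + 2 * i + k + 2) = a * b * c^2 * q^2" "q ^ (e + 2 * i + k + 1) = a * b * c^2 * q"
      "q ^ (e + 2 * i + k) = a * b * c^2" "q ^ (e + i + k) = a * b * c" "q ^ Suc i = c * q"
    by (simp_all add: a_def b_def c_def power_add power2_eq_square mult_2)
  \<comment> \<open>With \<open>1 - q\<close> opaque, denominators are powers of \<open>u\<close>;
    once they are cleared, a polynomial identity in \<open>q\<close>, \<open>a\<close>,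
    \<open>b\<close>, \<open>c\<close> remains.\<close>
  define u where "u = 1 - q"
  have u: "u \<noteq> 0" using q_neq_1 by (simp add: u_def)
  have "q ^ i * q_nat q (e + 2 * i + k + 2) * q_nat q (e + i + k)
      - q_nat q (e + 2 * i + k) * q_nat q (Suc i)
      = q ^ k * (q ^ i * q_nat q (e + 2 * i + k + 1) * q_nat q e)
        + q ^ i * q_nat q (e + 2 * i + k + 1) * q_nat q k
        - (1 - q) * (q_nat q (e + 2 * i + k + 1) * q_nat q (e + i + k) * q_nat q (Suc i))"
    unfolding q_nat_def pow a_def[symmetric] b_def[symmetric] c_def[symmetric] u_def[symmetric]
    using u by (simp add: divide_simps) (simp add: u_def, algebra)
  then show ?thesis
    unfolding 1 2 3 4 5 by (simp only: right_diff_distrib[symmetric] distrib_left[symmetric]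
        mult.left_commute[of _ F])
qed

lemma coeff_q_lucas:
  "coeff (q_lucas q k (e + 2 * j) t) e = lucas_coeff k e j * t ^ j"
proof (cases "e + 2 * j = 0")
  case True
  then show ?thesis by (simp add: q_lucas_def lucas_coeff_0)
next
  case False
  define n where "n = e + 2 * j"
  have eq_iff: "n - 2 * i = e \<longleftrightarrow> i = j" if "i \<in> {0..n div 2}" for i
    using that by (auto simp: n_def)
  have "coeff (q_lucas q k n t) e =
      (\<Sum>i=0..n div 2. if i = j then q ^ (j choose 2) * (q_nat q (n + k) / q_nat q (n + k - j))
                * q_binomial q (n + k - j) k * q_binomial q (n - j) j * t ^ j else 0)"
    using False by (auto simp: q_lucas_def coeff_sum n_def[symmetric] eq_iff intro!: sum.cong)
  also have "\<dots> = q ^ (j choose 2) * (q_nat q (n + k) / q_nat q (n + k - j))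
                * q_binomial q (n + k - j) k * q_binomial q (n - j) j * t ^ j"
    by (simp add: n_def)
  also have "\<dots> = lucas_coeff k e j * t ^ j"
  proof -
    \<comment> \<open>\<open>q_nat q (Suc p)\<close> cancels into \<open>q_fact q (Suc p)\<close>,
      and \<open>q_fact q (e + j)\<close> cancels between the two q-binomials.\<close>
    obtain p where p: "e + j + k = Suc p"
      using False by (cases "e + j + k") auto
    have "n + k - j = Suc p" "Suc p - k = e + j" "n - j = e + j" "e + j - j = e"
      using p by (simp_all add: n_def)
    moreover have "n + k = e + 2 * j + k"
      by (simp add: n_def)
    ultimately show ?thesis
      by (simp add: q_binomial_def lucas_coeff_eq[OF p] field_simps)
  qed
  finally show ?thesis by (simp add: n_def)
qed

lemma coeff_q_lucas_eq_0:
  assumes "\<And>j. n \<noteq> e + 2 * j"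
  shows "coeff (q_lucas q k n t) e = 0"
proof (cases "n = 0")
  case True
  then show ?thesis using assms[of 0] by (simp add: q_lucas_def)
next
  case False
  have "n - 2 * i \<noteq> e" if "i \<in> {0..n div 2}" for i
    using that assms[of i] by auto
  then show ?thesis
    using False by (auto simp: q_lucas_def coeff_sum intro!: sum.neutral)
qed

section \<open>Recurrence for the q-Lucas polynomials, with its defect\<close>

text \<open>An integer index lets the degree run below zero, so that no range conditions appear below.\<close>

definition int_lucas :: "nat \<Rightarrow> int \<Rightarrow> 'b poly"
  where "int_lucas k z = (if z < 0 then 0 else q_lucas q k (nat z) (- s))"

lemma int_lucas_neg: "z < 0 \<Longrightarrow> int_lucas k z = 0"
  by (simp add: int_lucas_def)

lemma coeff_int_lucas:
  assumes "z = int e + 2 * int j"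
  shows "coeff (int_lucas k z) e = lucas_coeff k e j * (- s) ^ j"
proof -
  have "nat z = e + 2 * j" using assms by simp
  then show ?thesis using assms by (simp add: int_lucas_def coeff_q_lucas)
qed

lemma coeff_int_lucas_eq_0:
  assumes "\<And>j. z \<noteq> int e + 2 * int j"
  shows "coeff (int_lucas k z) e = 0"
proof (cases "z < 0")
  case False
  have "nat z \<noteq> e + 2 * j" for j
    using assms[of j] False by auto
  then show ?thesis using False by (simp add: int_lucas_def coeff_q_lucas_eq_0)
qed (simp add: int_lucas_def)

text \<open>At \<open>z = -1\<close> the left side of the recurrence is \<open>L(0,0) = 1\<close>
  and the right side vanishes. At \<open>z = 1\<close> the left side is \<open>x^2 - q s\<close>,
  the right side \<open>x^2 + (1 - q) s\<close>.\<close>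

definition lucas_defect :: "nat \<Rightarrow> int \<Rightarrow> 'b"
  where "lucas_defect k z = (if k = 0 \<and> z = -1 then 1 else if k = 0 \<and> z = 1 then - s else 0)"

text \<open>At \<open>x^e\<close> everything vanishes unless \<open>z + 1 = e + 2 j\<close>. Then
  \<open>j = 0\<close> is the q-Pascal rule and \<open>j = Suc i\<close> is
  \<open>lucas_coeff_rec_Suc\<close>, apart from the two defects.\<close>

lemma int_lucas_rec:
  "int_lucas k (z + 1) + smult s (int_lucas k (z - 1)) =
    smult (q ^ k) ([:0, 1:] * int_lucas k z) + (if k = 0 then 0 else int_lucas (k - 1) (z + 1))
    + smult ((1 - q ^ Suc k) * s) (int_lucas (Suc k) (z - 1)) + [:lucas_defect k z:]"
  (is "?lhs = ?rhs")
proof (rule poly_eqI)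
  fix e
  have shift: "coeff ([:0, 1:] * int_lucas k z) e = (if e = 0 then 0 else coeff (int_lucas k z) (e - 1))"
    by (cases e) simp_all
  show "coeff ?lhs e = coeff ?rhs e"
  proof (cases "\<exists>j. z + 1 = int e + 2 * int j")
    case False
    then have ne: "z + 1 \<noteq> int e + 2 * int j" for j by blast
    have "coeff (int_lucas k' (z + 1)) e = 0" for k'
      using ne by (rule coeff_int_lucas_eq_0)
    moreover have "coeff (int_lucas k' (z - 1)) e = 0" for k'
      using ne[of "Suc _"] by (intro coeff_int_lucas_eq_0) (auto simp: algebra_simps)
    moreover have "e = 0 \<or> coeff (int_lucas k z) (e - 1) = 0"
    proof (cases e)
      case (Suc e')
      then show ?thesis
        using ne by (intro disjI2 coeff_int_lucas_eq_0) (auto simp: algebra_simps)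
    qed simp
    moreover have "coeff [:lucas_defect k z:] e = 0"
      using ne[of 0] ne[of 1] by (cases e) (auto simp: lucas_defect_def)
    ultimately show ?thesis
      by (simp only: coeff_add coeff_smult shift) auto
  next
    case True
    then obtain j where j: "z + 1 = int e + 2 * int j" by blast
    have c: "coeff (int_lucas k' (z + 1)) e = lucas_coeff k' e j * (- s) ^ j" for k'
      using j by (rule coeff_int_lucas)
    have cx: "coeff ([:0, 1:] * int_lucas k z) e
        = (if e = 0 then 0 else lucas_coeff k (e - 1) j) * (- s) ^ j"
    proof (cases e)
      case (Suc e')
      then show ?thesis
        using j by (simp add: coeff_int_lucas)
    qed simp
    have defect: "coeff [:lucas_defect k z:] e =
        (if k = 0 \<and> e = 0 then if j = 0 then 1 else if j = 1 then - s else 0 else 0)"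
      using j by (cases e) (auto simp: lucas_defect_def)
    have rhs: "coeff ?rhs e = q ^ k * ((if e = 0 then 0 else lucas_coeff k (e - 1) j) * (- s) ^ j)
        + (if k = 0 then 0 else lucas_coeff (k - 1) e j) * (- s) ^ j
        + (1 - q ^ Suc k) * s * coeff (int_lucas (Suc k) (z - 1)) e
        + (if k = 0 \<and> e = 0 then if j = 0 then 1 else if j = 1 then - s else 0 else 0)"
      by (simp only: coeff_add coeff_smult cx defect) (simp add: c)
    show ?thesis
    proof (cases j)
      case 0
      \<comment> \<open>Here \<open>z - 1 = e - 2\<close> is below the degree
        \<open>e\<close>.\<close>
      have "coeff (int_lucas k' (z - 1)) e = 0" for k'
        using j 0 by (intro coeff_int_lucas_eq_0) auto
      then show ?thesis
        unfolding rhs using lucas_coeff_rec_0[of k e] 0 c[of k]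
        by (cases "k = 0 \<and> e = 0") (auto simp: lucas_coeff_0)
    next
      case (Suc i)
      have d: "coeff (int_lucas k' (z - 1)) e = lucas_coeff k' e i * (- s) ^ i" for k'
        using j Suc by (intro coeff_int_lucas) simp
      show ?thesis
      \<comment> \<open>This case has \<open>z = 1\<close>; it lies outside
        \<open>lucas_coeff_rec_Suc\<close>, and the defect \<open>- s\<close> enters.\<close>
      proof (cases "k = 0 \<and> e = 0 \<and> i = 0")
        case True
        moreover have "q_nat q 2 = 1 + q"
          using q_nat_add[of 1 1] by (simp add: numeral_2_eq_2)
        ultimately show ?thesis
          unfolding rhs using Suc lucas_coeff_eq[of 0 1 0 0] c[of k] d
          by (simp add: lucas_coeff_0 numeral_2_eq_2) (simp add: algebra_simps)
      next
        case False
        then have "e + i + k > 0" by auto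
        note rec = lucas_coeff_rec_Suc[OF this]
        have "coeff ?lhs e = (lucas_coeff k e (Suc i) - lucas_coeff k e i) * (- s) ^ Suc i"
          by (simp add: c d Suc) (simp add: algebra_simps)
        also have "\<dots> = coeff ?rhs e"
          unfolding rec rhs using False Suc by (auto simp: d algebra_simps)
        finally show ?thesis .
      qed
    qed
  qed
qed

section \<open>Normal-ordering coefficients and their recurrence\<close>

definition normal_coeff :: "nat \<Rightarrow> nat \<Rightarrow> 'b poly"
  where "normal_coeff n k =
    (\<Sum>i\<le>n. smult (of_nat (n choose i) * s ^ i) (int_lucas k (int n - 2 * int i - int k)))"

text \<open>The terms with \<open>i > (n - k) div 2\<close> have a negative index and
  vanish.\<close>

lemma normal_coeff_eq_A_poly:
  assumes "k \<le> n"
  shows "normal_coeff n k = A_poly q s n k"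
proof -
  have "normal_coeff n k = (\<Sum>i=0..(n - k) div 2.
      smult (of_nat (n choose i) * s ^ i) (int_lucas k (int n - 2 * int i - int k)))"
    unfolding normal_coeff_def
    by (rule sum.mono_neutral_right) (use assms in \<open>auto simp: int_lucas_def\<close>)
  also have "\<dots> = A_poly q s n k"
    unfolding A_poly_def
  proof (rule sum.cong)
    fix i assume "i \<in> {0..(n - k) div 2}"
    then have "int n - 2 * int i - int k = int (n - 2 * i - k)"
      using assms by auto
    then show "smult (of_nat (n choose i) * s ^ i) (int_lucas k (int n - 2 * int i - int k)) =
        smult (of_nat (n choose i) * s ^ i) (q_lucas q k (n - 2 * i - k) (- s))"
      by (simp only: int_lucas_def nat_int) simp
  qed simp
  finally show ?thesis .
qed

lemma normal_coeff_eq_0: "n < k \<Longrightarrow> normal_coeff n k = 0"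
  by (simp add: normal_coeff_def int_lucas_neg)

text \<open>Only \<open>k = 0\<close>, \<open>n = 2 p + 1\<close> matters: \<open>i = p\<close>
  contributes \<open>- s^(p+1)\<close> and \<open>i = p + 1\<close> contributes
  \<open>s^(p+1)\<close>, with equal binomial coefficients.\<close>

lemma sum_lucas_defect:
  "(\<Sum>i\<le>n. of_nat (n choose i) * s ^ i * lucas_defect k (int n - 2 * int i - int k)) = 0"
proof (cases "k = 0 \<and> odd n")
  case False
  then have "lucas_defect k (int n - 2 * int i - int k) = 0" for i
    by (auto simp: lucas_defect_def) presburger+
  then show ?thesis by simp
next
  case True
  then obtain p where [simp]: "n = 2 * p + 1" "k = 0" by (auto elim: oddE)
  have "(\<Sum>i\<le>n. of_nat (n choose i) * s ^ i * lucas_defect k (int n - 2 * int i - int k)) =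
      (\<Sum>i\<in>{p, Suc p}. of_nat (n choose i) * s ^ i * lucas_defect k (int n - 2 * int i - int k))"
    by (rule sum.mono_neutral_right) (auto simp: lucas_defect_def)
  also have "\<dots> = 0"
    using binomial_symmetric[of p n] by (simp add: lucas_defect_def)
  finally show ?thesis .
qed

lemma normal_coeff_0: "normal_coeff 0 0 = 1"
  by (simp add: normal_coeff_def int_lucas_def q_lucas_def)

lemma normal_coeff_Suc:
  "normal_coeff (Suc n) k =
    smult (q ^ k) ([:0, 1:] * normal_coeff n k)
    + (if k = 0 then 0 else normal_coeff n (k - 1))
    + smult ((1 - q ^ Suc k) * s) (normal_coeff n (Suc k))"
proof -
  define z where "z i = int n - 2 * int i - int k" for i
  define b where "b i = (of_nat (n choose i) * s ^ i :: 'b)" for i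
  \<comment> \<open>Pascal's rule in \<open>i\<close>; the \<open>if\<close> keeps
    \<open>0 - 1 = 0\<close> from counting \<open>n choose 0\<close> twice.\<close>
  have "normal_coeff (Suc n) k =
      (\<Sum>i\<le>Suc n. smult (of_nat (n choose i) * s ^ i) (int_lucas k (z i + 1)))
      + (\<Sum>i\<le>Suc n. smult (of_nat (if i = 0 then 0 else n choose (i - 1)) * s ^ i) (int_lucas k (z i + 1)))"
    unfolding normal_coeff_def sum.distrib[symmetric]
  proof (rule sum.cong)
    fix i
    show "smult (of_nat (Suc n choose i) * s ^ i) (int_lucas k (int (Suc n) - 2 * int i - int k)) =
        smult (of_nat (n choose i) * s ^ i) (int_lucas k (z i + 1))
        + smult (of_nat (if i = 0 then 0 else n choose (i - 1)) * s ^ i) (int_lucas k (z i + 1))"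
      by (cases i) (simp_all add: z_def algebra_simps smult_add_left)
  qed simp
  also have "(\<Sum>i\<le>Suc n. smult (of_nat (n choose i) * s ^ i) (int_lucas k (z i + 1)))
      = (\<Sum>i\<le>n. smult (b i) (int_lucas k (z i + 1)))"
    by (simp add: b_def binomial_eq_0)
  \<comment> \<open>Since \<open>z (Suc i) + 1 = z i - 1\<close>, the shift produces the second term
    on the left of \<open>int_lucas_rec\<close>.\<close>
  also have "(\<Sum>i\<le>Suc n. smult (of_nat (if i = 0 then 0 else n choose (i - 1)) * s ^ i) (int_lucas k (z i + 1)))
      = (\<Sum>i\<le>n. smult (b i) (smult s (int_lucas k (z i - 1))))"
    by (subst sum.atMost_Suc_shift) (simp add: b_def z_def algebra_simps)
  also have "(\<Sum>i\<le>n. smult (b i) (int_lucas k (z i + 1)))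
        + (\<Sum>i\<le>n. smult (b i) (smult s (int_lucas k (z i - 1))))
      = (\<Sum>i\<le>n. smult (b i) (int_lucas k (z i + 1) + smult s (int_lucas k (z i - 1))))"
    by (simp only: sum.distrib smult_add_right)
  also have "\<dots> = (\<Sum>i\<le>n. smult (b i) (smult (q ^ k) ([:0, 1:] * int_lucas k (z i))))
      + (\<Sum>i\<le>n. smult (b i) (if k = 0 then 0 else int_lucas (k - 1) (z i + 1)))
      + (\<Sum>i\<le>n. smult (b i) (smult ((1 - q ^ Suc k) * s) (int_lucas (Suc k) (z i - 1))))
      + (\<Sum>i\<le>n. smult (b i) [:lucas_defect k (z i):])"
    by (simp only: int_lucas_rec smult_add_right sum.distrib)
  also have "(\<Sum>i\<le>n. smult (b i) (smult (q ^ k) ([:0, 1:] * int_lucas k (z i))))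
      = smult (q ^ k) ([:0, 1:] * normal_coeff n k)"
    unfolding normal_coeff_def sum_distrib_left smult_sum_right z_def b_def
    by (simp only: mult_smult_right smult_smult mult.commute)
  \<comment> \<open>Lowering \<open>k\<close> by one raises \<open>z i\<close> by one; raising
    \<open>k\<close> lowers it.\<close>
  also have "(\<Sum>i\<le>n. smult (b i) (if k = 0 then 0 else int_lucas (k - 1) (z i + 1)))
      = (if k = 0 then 0 else normal_coeff n (k - 1))"
    by (simp add: normal_coeff_def z_def b_def of_nat_diff algebra_simps)
  also have "(\<Sum>i\<le>n. smult (b i) (smult ((1 - q ^ Suc k) * s) (int_lucas (Suc k) (z i - 1))))
      = smult ((1 - q ^ Suc k) * s) (normal_coeff n (Suc k))"
    by (simp add: normal_coeff_def z_def b_def smult_sum_right algebra_simps)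
  also have "(\<Sum>i\<le>n. smult (b i) [:lucas_defect k (z i):]) = 0"
  proof -
    have "(\<Sum>i\<le>n. smult (b i) [:lucas_defect k (z i):]) = [:\<Sum>i\<le>n. b i * lucas_defect k (z i):]"
      by (rule poly_eqI) (auto simp: coeff_sum coeff_pCons split: nat.split)
    then show ?thesis
      by (simp add: b_def z_def sum_lucas_defect)
  qed
  finally show ?thesis by simp
qed

section \<open>The operator Y and its commutation with X\<close>

definition Y_op :: "'b poly \<Rightarrow> 'b poly"
  where "Y_op f = smult ((1 - q) * s) (q_diff q f)"

text \<open>Multiplying by \<open>x\<close> undoes the division in \<open>q_diff\<close>. As
  \<open>x\<close> can be cancelled, this equation characterizes \<open>Y_op f\<close>.\<close>

lemma X_mult_Y_op: "[:0, 1:] * Y_op f = smult s (f - pcompose f [:0, q:])"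
proof -
  have "[:0, 1:] * Y_op f = smult (- s) ([:0, q - 1:] * q_diff q f)"
    by (simp add: Y_op_def algebra_simps)
  also have "\<dots> = smult s (f - pcompose f [:0, q:])"
    unfolding q_diff_exact[OF q_neq_1] by (simp add: smult_diff_right)
  finally show ?thesis .
qed

lemma Y_op_unique: "[:0, 1:] * g = smult s (f - pcompose f [:0, q:]) \<Longrightarrow> Y_op f = g"
  using X_mult_Y_op[of f] mult_cancel_left[of "[:0, 1:]" "Y_op f" g] by simp

lemma Y_op_add: "Y_op (f + g) = Y_op f + Y_op g"
  by (rule Y_op_unique)
    (simp only: distrib_left X_mult_Y_op pcompose_add smult_diff_right smult_add_right, simp)

lemma Y_op_smult: "Y_op (smult c f) = smult c (Y_op f)"
  by (rule Y_op_unique)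
    (simp only: mult_smult_right X_mult_Y_op pcompose_smult, simp add: smult_diff_right mult.commute)

text \<open>The substitution turns \<open>x f(x)\<close> into \<open>q x f(q x)\<close>, whence the
  factor \<open>q\<close>; what is left over is \<open>(1 - q) s f\<close>.\<close>

lemma Y_op_X: "Y_op ([:0, 1:] * f) = smult q ([:0, 1:] * Y_op f) + smult ((1 - q) * s) f"
proof (rule Y_op_unique)
  have "pcompose ([:0, 1:] * f) [:0, q:] = [:0, q:] * pcompose f [:0, q:]"
    by (simp add: pcompose_mult pcompose_pCons)
  then show "[:0, 1:] * (smult q ([:0, 1:] * Y_op f) + smult ((1 - q) * s) f) =
      smult s ([:0, 1:] * f - pcompose ([:0, 1:] * f) [:0, q:])"
    unfolding X_mult_Y_op
    by (simp add: smult_diff_right smult_diff_left algebra_simps)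
qed

lemma Y_op_funpow_add: "(Y_op ^^ k) (f + g) = (Y_op ^^ k) f + (Y_op ^^ k) g"
  by (induction k) (simp_all add: Y_op_add)

lemma Y_op_funpow_X:
  "(Y_op ^^ k) ([:0, 1:] * f) =
    smult (q ^ k) ([:0, 1:] * (Y_op ^^ k) f) + smult ((1 - q ^ k) * s) ((Y_op ^^ (k - 1)) f)"
proof (induction k)
  case (Suc k)
  \<comment> \<open>At \<open>k = 0\<close> the truncated \<open>k - 1\<close> is harmless, because
    the scalar is zero.\<close>
  have *: "smult ((1 - q ^ k) * s) (Y_op ((Y_op ^^ (k - 1)) f)) = smult ((1 - q ^ k) * s) ((Y_op ^^ k) f)"
    by (cases k) simp_all
  have "(Y_op ^^ Suc k) ([:0, 1:] * f) = smult (q ^ k) (Y_op ([:0, 1:] * (Y_op ^^ k) f))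
      + smult ((1 - q ^ k) * s) ((Y_op ^^ k) f)"
    using Suc by (simp only: funpow.simps o_apply Y_op_add Y_op_smult *)
  also have "\<dots> = smult (q ^ Suc k) ([:0, 1:] * (Y_op ^^ Suc k) f)
      + smult (q ^ k * ((1 - q) * s) + (1 - q ^ k) * s) ((Y_op ^^ k) f)"
    unfolding Y_op_X by (simp only: smult_add_right smult_add_left smult_smult funpow.simps o_apply
        power_Suc2 add.assoc)
  also have "q ^ k * ((1 - q) * s) + (1 - q ^ k) * s = (1 - q ^ Suc k) * s"
    by (simp add: algebra_simps)
  finally show ?case by simp
qed simp

lemma Y_op_funpow: "(Y_op ^^ k) f = smult ((1 - q) ^ k * s ^ k) ((q_diff q ^^ k) f)"
proof (induction k)
  case (Suc k)
  have "Y_op ((Y_op ^^ k) f) = smult ((1 - q) ^ k * s ^ k) (Y_op ((q_diff q ^^ k) f))"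
    unfolding Suc Y_op_smult ..
  then show ?case by (simp add: Y_op_def[of "(q_diff q ^^ k) f"] ac_simps)
qed simp

section \<open>Normal form of the powers of X + Y\<close>

theorem funpow_X_plus_Y:
  "((\<lambda>f. [:0, 1:] * f + Y_op f) ^^ n) f = (\<Sum>k\<le>n. normal_coeff n k * (Y_op ^^ k) f)"
proof (induction n arbitrary: f)
  case 0
  show ?case by (simp add: normal_coeff_0)
next
  case (Suc n)
  let ?x = "[:0, 1:] :: 'b poly"
  let ?y = "\<lambda>k. (Y_op ^^ k) f"
  let ?A = "normal_coeff n"
  let ?c = "\<lambda>k. (1 - q ^ k) * s"
  \<comment> \<open>The induction hypothesis is used at \<open>?x * f + Y_op f\<close>: the new
    factor acts first, on the right.\<close>
  have "((\<lambda>f. ?x * f + Y_op f) ^^ Suc n) f = (\<Sum>k\<le>n. ?A k * (Y_op ^^ k) (?x * f + Y_op f))"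
    by (simp only: funpow_Suc_right o_apply Suc)
  also have "\<dots> = (\<Sum>k\<le>n. ?A k * smult (q ^ k) (?x * ?y k))
      + (\<Sum>k\<le>n. ?A k * smult (?c k) (?y (k - 1))) + (\<Sum>k\<le>n. ?A k * ?y (Suc k))"
    by (simp only: Y_op_funpow_add Y_op_funpow_X distrib_left sum.distrib funpow_Suc_right o_apply)
  also have "(\<Sum>k\<le>n. ?A k * smult (q ^ k) (?x * ?y k))
      = (\<Sum>k\<le>Suc n. smult (q ^ k) (?x * ?A k) * ?y k)"
    by (simp add: normal_coeff_eq_0 algebra_simps)
  also have "(\<Sum>k\<le>n. ?A k * ?y (Suc k)) = (\<Sum>k\<le>Suc n. (if k = 0 then 0 else ?A (k - 1)) * ?y k)"
    by (subst sum.atMost_Suc_shift) simp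
  \<comment> \<open>Two zero terms are added, so that dropping \<open>k = 0\<close>, where
    \<open>?c 0 = 0\<close>, and shifting gives the range \<open>k \<le> Suc n\<close>.\<close>
  also have "(\<Sum>k\<le>n. ?A k * smult (?c k) (?y (k - 1)))
      = (\<Sum>k\<le>Suc (Suc n). ?A k * smult (?c k) (?y (k - 1)))"
    by (simp add: normal_coeff_eq_0)
  also have "\<dots> = (\<Sum>k\<le>Suc n. smult (?c (Suc k)) (?A (Suc k)) * ?y k)"
    by (subst sum.atMost_Suc_shift) (simp del: sum.atMost_Suc)
  also have "(\<Sum>k\<le>Suc n. smult (q ^ k) (?x * ?A k) * ?y k)
      + (\<Sum>k\<le>Suc n. smult (?c (Suc k)) (?A (Suc k)) * ?y k)
      + (\<Sum>k\<le>Suc n. (if k = 0 then 0 else ?A (k - 1)) * ?y k)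
      = (\<Sum>k\<le>Suc n. normal_coeff (Suc n) k * ?y k)"
    unfolding normal_coeff_Suc sum.distrib[symmetric] distrib_right[symmetric]
    by (intro sum.cong) (simp_all only: ac_simps)
  finally show ?case .
qed

end

section \<open>Specialization to the indeterminates\<close>

lemma q_indet_power_neq_1:
  assumes "n > 0"
  shows "(q_indet :: 'a::field poly poly fract) ^ n \<noteq> 1"
proof
  assume "(q_indet :: 'a poly poly fract) ^ n = 1"
  moreover have "(q_indet :: 'a poly poly fract) ^ n = to_fract ([:[:0, 1:]:] ^ n)"
    unfolding q_indet_def by (induction n) (simp_all only: power_0 to_fract_1 power_Suc to_fract_mult)
  ultimately have "([:[:0, 1:]:] :: 'a poly poly) ^ n = 1"
    by (metis to_fract_1 to_fract_eq_iff)
  \<comment> \<open>Setting \<open>s = 0\<close> and then \<open>q = 0\<close> sends the power to 0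
    and the constant to 1.\<close>
  then have "poly (poly ([:[:0, 1:]:] ^ n) 0) 0 = poly (poly (1 :: 'a poly poly) 0) 0"
    by simp
  then show False
    using assms by (simp add: poly_power power_0_left)
qed

theorem theorem4:
  fixes q s :: "'a::field poly poly fract" and n :: nat
  assumes "q = q_indet" and "s = s_indet"
  shows "(\<lambda>f. X_op f + smult ((1 - q) * s) (q_diff q f)) ^^ n =
    (\<lambda>f. \<Sum>k=0..n. mult_op (A_poly q s n k) (smult ((1 - q) ^ k * s ^ k) ((q_diff q ^^ k) f)))"
proof -
  interpret generic_q q s
    by unfold_locales (simp add: assms q_indet_power_neq_1)
  have "((\<lambda>f. [:0, 1:] * f + Y_op f) ^^ n) f =
      (\<Sum>k=0..n. A_poly q s n k * smult ((1 - q) ^ k * s ^ k) ((q_diff q ^^ k) f))" for f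
    unfolding funpow_X_plus_Y Y_op_funpow
    by (intro sum.cong) (auto simp: normal_coeff_eq_A_poly)
  then show ?thesis
    unfolding mult_op_def Y_op_def by (intro ext)
qed

end
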